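(* Let $L$ be a $T_1$ topological space with $|L|>1$, and let $\kappa$ be an infinite cardinal with $d(L)\leq\kappa$. Then there is a subspace $X$ of $L^{2^\kappa}$ such that $|X|=\kappa$, $X$ is $\kappa$-dense in $L^{2^\kappa}$, and $X$ is submaximal.
   Context: Here $d(L)$ is the density of $L$, i.e. the smallest cardinality of a dense subset of $L$. The power $L^{2^\kappa}$ (the product of $2^\kappa$ copies of $L$) carries the Tychonoff product topology. A set $A$ is called $\kappa$-dense in a space $Y$ if $|A\cap U|\geq\kappa$ for every nonempty open $U\subseteq Y$. A space is crowded if it has no isolated points. A crowded space $X$ is called submaximal if every dense subset of $X$ is open in $X$. *)

theory Defs
  imports "HOL-Analysis.Analysis"
begin

unbundle cardinal_syntax

definition dense_subset_of :: "'a topology \<Rightarrow> 'a set \<Rightarrow> bool"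
  where "dense_subset_of Y D \<longleftrightarrow> D \<subseteq> topspace Y \<and> Y closure_of D = topspace Y"

(* d(Y), represented as a cardinal order. The choice only selects a representative:
   by density_attained and density_least the result is, up to =o, the smallest
   cardinality of a dense subset. *)
definition top_density :: "'a topology \<Rightarrow> 'a rel"
  where "top_density Y =
    |SOME D. dense_subset_of Y D \<and> (\<forall>E. dense_subset_of Y E \<longrightarrow> |D| \<le>o |E| )|"

lemma density_witness:
  "\<exists>D. dense_subset_of Y D \<and> (\<forall>E. dense_subset_of Y E \<longrightarrow> |D| \<le>o |E| )"
proof -
  let ?R = "{ |E| | E. dense_subset_of Y E}"
  have "dense_subset_of Y (topspace Y)"
    by (simp add: dense_subset_of_def)
  then have "?R \<noteq> {}" by blast
  moreover have "\<forall>r\<in>?R. Card_order r" by (auto simp: card_of_Card_order)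
  ultimately have "\<exists>r\<in>?R. \<forall>r'\<in>?R. r \<le>o r'"
    by (rule exists_minim_Card_order)
  then show ?thesis by blast
qed

lemma density_attained: "\<exists>D. dense_subset_of Y D \<and> |D| =o top_density Y"
  unfolding top_density_def using someI_ex[OF density_witness[of Y]] card_of_refl by blast

lemma density_least: "dense_subset_of Y E \<Longrightarrow> top_density Y \<le>o |E|"
  unfolding top_density_def using someI_ex[OF density_witness[of Y]] by blast

definition kappa_dense :: "'k rel \<Rightarrow> 'a topology \<Rightarrow> 'a set \<Rightarrow> bool"
  where "kappa_dense \<kappa> Y A \<longleftrightarrow>
    A \<subseteq> topspace Y \<and> (\<forall>U. openin Y U \<and> U \<noteq> {} \<longrightarrow> \<kappa> \<le>o |A \<inter> U| )"

definition crowded :: "'a topology \<Rightarrow> bool"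
  where "crowded Y \<longleftrightarrow> (\<forall>x\<in>topspace Y. \<not> openin Y {x})"

definition submaximal :: "'a topology \<Rightarrow> bool"
  where "submaximal Y \<longleftrightarrow> crowded Y \<and> (\<forall>D. dense_subset_of Y D \<longrightarrow> openin Y D)"

end

theory Submission
  imports Defs "HOL-Algebra.Free_Abelian_Groups"
begin

text \<open>
  A subspace of the power \<open>L\<^sup>I\<close> is the same thing as a set \<open>M\<close> of labels together with coordinate
  functions \<open>f i\<close> from \<open>M\<close> to \<open>L\<close>: the point labelled \<open>m\<close> has \<open>i\<close>-th coordinate \<open>f i m\<close>. If distinct
  labels give distinct points, the subspace is \<open>\<kappa>\<close>-dense as soon as the family is
  \<open>\<kappa>\<close>-independent, that is, every finite system
  of conditions \<open>f i m \<in> U i\<close>, one for each of finitely many distinct \<open>i\<close> and each with \<open>U i\<close>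
  nonempty and open, has at least \<open>\<kappa>\<close> solutions. The construction behind the
  Hewitt-Marczewski-Pondiczery theorem gives an independent family of \<open>2\<^sup>\<kappa>\<close> functions on a set of
  size \<open>\<kappa>\<close> (lemma \<open>independent_family_on_Pow\<close>).

  The coordinates are then altered so as to make as many sets as possible closed. To close a set \<open>E\<close>
  against a point \<open>x \<notin> E\<close>, one coordinate \<open>i\<close> suffices: redefine \<open>f i\<close> on \<open>E\<close> to be constantly some
  value \<open>y\<close> other than \<open>f i x\<close>. Since \<open>L\<close> is \<open>T\<^sub>1\<close>, the condition \<open>f i m \<noteq> y\<close> is an open
  neighbourhood of \<open>x\<close> that misses \<open>E\<close>. There are only \<open>2\<^sup>\<kappa>\<close> pairs \<open>(E, x)\<close>, so every pair can have a
  coordinate of its own. A finite system of conditions involves only finitely many of the sets \<open>E\<close>,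
  and off these it is unchanged. Hence independence survives if exactly the sets of a
  family \<open>\<J>\<close> are closed in this way, provided that every finite system of conditions on the
  original functions keeps \<open>\<kappa>\<close> solutions after finitely many members of \<open>\<J>\<close> are removed.

  Take \<open>\<J>\<close> maximal with this property. It contains every set of size below \<open>\<kappa>\<close>; in particular
  singletons, and the coordinates reserved for them separate the labels. It also contains the
  complement \<open>E\<close> of each dense set of the new space (lemma \<open>codense_in_J\<close>): otherwise maximality
  yields a basic open set which, after removal of finitely many members of \<open>\<J>\<close>, lies in \<open>E\<close> except
  for fewer than \<open>\<kappa>\<close> points. Those exceptional points form another member of \<open>\<J>\<close>, so without them
  there remains a nonempty open subset of \<open>E\<close>, although \<open>E\<close> has a dense complement. So complements
  of dense sets are closed, which is submaximality.
\<close>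

section \<open>Families of functions with large finite intersections\<close>

definition cylinder :: "('i \<Rightarrow> 'm \<Rightarrow> 'a) \<Rightarrow> 'm set \<Rightarrow> 'i set \<Rightarrow> ('i \<Rightarrow> 'a set) \<Rightarrow> 'm set"
  where "cylinder f M a U = {m \<in> M. \<forall>i\<in>a. f i m \<in> U i}"

definition admissible :: "'a topology \<Rightarrow> 'i set \<Rightarrow> 'i set \<Rightarrow> ('i \<Rightarrow> 'a set) \<Rightarrow> bool"
  where "admissible L I a U \<longleftrightarrow>
    finite a \<and> a \<subseteq> I \<and> (\<forall>i\<in>a. openin L (U i) \<and> U i \<noteq> {})"

text \<open>
  For \<open>\<J> = {}\<close> this is \<open>\<kappa>\<close>-independence of the family. In general it is \<open>\<kappa>\<close>-independence modulo the
  ideal generated by \<open>\<J>\<close>; finite subfamilies take the place of that ideal, which makes the property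
  one of finite character in \<open>\<J>\<close>.
\<close>

definition abundant_off ::
    "'k rel \<Rightarrow> 'a topology \<Rightarrow> 'i set \<Rightarrow> 'm set \<Rightarrow> ('i \<Rightarrow> 'm \<Rightarrow> 'a) \<Rightarrow> 'm set set \<Rightarrow> bool"
  where "abundant_off \<kappa> L I M f \<J> \<longleftrightarrow>
    (\<forall>a U \<F>. admissible L I a U \<and> finite \<F> \<and> \<F> \<subseteq> \<J> \<longrightarrow> \<kappa> \<le>o |cylinder f M a U - \<Union>\<F>| )"

lemma abundant_offD:
  "\<lbrakk>abundant_off \<kappa> L I M f \<J>; admissible L I a U; finite \<F>; \<F> \<subseteq> \<J>\<rbrakk>
    \<Longrightarrow> \<kappa> \<le>o |cylinder f M a U - \<Union>\<F>|"
  unfolding abundant_off_def by blast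

lemma abundant_off_mono:
  "\<lbrakk>abundant_off \<kappa> L I M f \<J>; \<J>' \<subseteq> \<J>\<rbrakk> \<Longrightarrow> abundant_off \<kappa> L I M f \<J>'"
  unfolding abundant_off_def by blast

lemma not_Cinfinite_le_card_finite:
  assumes "Cinfinite \<kappa>" "finite A" shows "\<not> \<kappa> \<le>o |A|"
proof
  assume "\<kappa> \<le>o |A|"
  then have "finite (Field \<kappa>)"
    using assms by (metis card_of_ordLeq_finite card_of_Field_ordIso ordIso_ordLeq_trans)
  then show False using assms by (simp add: cinfinite_def)
qed

lemma less_if_not_Cinfinite_le:
  assumes "Cinfinite \<kappa>" "\<not> \<kappa> \<le>o |A|" shows "|A| <o \<kappa>"
  using assms by (metis card_of_Well_order card_order_on_well_order_on not_ordLeq_iff_ordLess)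

section \<open>An independent family of functions on a set of size \<open>\<kappa>\<close>\<close>

text \<open>One point of \<open>C\<close> for each pair of distinct members of \<open>a\<close> is enough to tell them all apart.\<close>

lemma finite_trace_separates:
  assumes "finite a" "\<forall>A\<in>a. A \<subseteq> C"
  obtains F where "finite F" "F \<subseteq> C" "inj_on (\<lambda>A. A \<inter> F) a"
proof -
  have "\<exists>p. A \<in> a \<longrightarrow> B \<in> a \<longrightarrow> A \<noteq> B \<longrightarrow> p \<in> C \<and> (p \<in> A) \<noteq> (p \<in> B)" for A B
    using assms(2) by blast
  then obtain p where p: "\<And>A B. \<lbrakk>A \<in> a; B \<in> a; A \<noteq> B\<rbrakk> \<Longrightarrow> p A B \<in> C \<and> (p A B \<in> A) \<noteq> (p A B \<in> B)"
    by metis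
  define F where "F = (\<lambda>(A, B). p A B) ` {q \<in> a \<times> a. fst q \<noteq> snd q}"
  have "finite F" unfolding F_def using assms(1) by simp
  moreover have "F \<subseteq> C" unfolding F_def by clarsimp (use p in blast)
  moreover have "inj_on (\<lambda>A. A \<inter> F) a"
  proof (rule inj_onI, rule ccontr)
    fix A B assume AB: "A \<in> a" "B \<in> a" "A \<inter> F = B \<inter> F" "A \<noteq> B"
    then have "p A B \<in> F" unfolding F_def by force
    with AB p[of A B] show False by blast
  qed
  ultimately show ?thesis using that by blast
qed

lemma card_of_Times_absorb:
  assumes "infinite C" "|A| =o |C|" "|B| \<le>o |C|" "B \<noteq> {}"
  shows "|A \<times> B| =o |C|"
proof -
  have "infinite A" using assms(1) card_of_ordIso_finite[OF assms(2)] by simp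
  moreover have "|B| \<le>o |A|" by (rule ordLeq_ordIso_trans[OF assms(3) ordIso_symmetric[OF assms(2)]])
  ultimately have "|A \<times> B| =o |A|" using assms(4) by (intro card_of_Times_infinite_simps(1))
  then show ?thesis using assms(2) by (rule ordIso_transitive)
qed

text \<open>
  The functions are indexed by subsets \<open>A\<close> of the field of \<open>\<kappa>\<close>. A label carries a finite set \<open>F\<close> and
  a finite table \<open>R\<close> from finite sets to a dense set \<open>D\<close>, and the value at \<open>A\<close> is found by looking up
  the trace \<open>A \<inter> F\<close> in \<open>R\<close>. Finitely many sets have distinct traces on a suitable \<open>F\<close>, so the values
  at them can be prescribed independently within \<open>D\<close>, which meets every nonempty open set.
\<close>

lemma independent_family_on_Pow:
  fixes \<kappa> :: "'k rel" and L :: "'a topology"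
  assumes \<kappa>: "Cinfinite \<kappa>" and D: "dense_subset_of L D" "|D| \<le>o \<kappa>" "D \<noteq> {}"
  obtains M :: "('k \<times> 'k set \<times> ('k set \<times> 'a) list) set" and f
  where "|M| =o \<kappa>" "\<And>A m. m \<in> M \<Longrightarrow> f A m \<in> topspace L"
    "abundant_off \<kappa> L (Pow (Field \<kappa>)) M f {}"
proof -
  let ?C = "Field \<kappa>"
  obtain d0 where d0: "d0 \<in> D" using D(3) by blast
  have DL: "D \<subseteq> topspace L" using D(1) by (simp add: dense_subset_of_def)
  have infC: "infinite ?C" using \<kappa> by (simp add: cinfinite_def)
  have C: "|?C| =o \<kappa>" using \<kappa> card_of_Field_ordIso by blast
  \<comment> \<open>The first component has no influence on the values: it repeats each label \<open>\<kappa>\<close> times, so that a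
    system of conditions with one solution has \<open>\<kappa>\<close> of them.\<close>
  define M where "M = ?C \<times> Fpow ?C \<times> lists (Fpow ?C \<times> D)"
  define f :: "'k set \<Rightarrow> ('k \<times> 'k set \<times> ('k set \<times> 'a) list) \<Rightarrow> 'a"
    where "f A = (\<lambda>(\<alpha>, F, R). case map_of R (A \<inter> F) of Some d \<Rightarrow> d | None \<Rightarrow> d0)" for A
  have Fpow: "|Fpow ?C| =o |?C|" using infC by (rule card_of_Fpow_infinite)
  have "|D| \<le>o |?C|" by (rule ordLeq_ordIso_trans[OF D(2) ordIso_symmetric[OF C]])
  with infC Fpow have FD: "|Fpow ?C \<times> D| =o |?C|" using D(3) by (rule card_of_Times_absorb)
  then have "infinite (Fpow ?C \<times> D)" using infC card_of_ordIso_finite[OF FD] by simp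
  then have lists: "|lists (Fpow ?C \<times> D)| =o |?C|"
    by (rule ordIso_transitive[OF card_of_lists_infinite FD])
  have "|Fpow ?C \<times> lists (Fpow ?C \<times> D)| =o |?C|"
    using infC Fpow ordIso_imp_ordLeq[OF lists] by (rule card_of_Times_absorb) blast
  moreover have "Fpow ?C \<times> lists (Fpow ?C \<times> D) \<noteq> {}" by (auto simp: Fpow_def)
  ultimately have "|M| =o |?C|" unfolding M_def
    using infC card_of_refl ordIso_imp_ordLeq by (intro card_of_Times_absorb)
  then have 1: "|M| =o \<kappa>" using C ordIso_transitive by blast
  have 2: "f A m \<in> topspace L" if "m \<in> M" for A m
  proof -
    obtain \<alpha> F R where m: "m = (\<alpha>, F, R)" by (cases m)
    have "set R \<subseteq> Fpow ?C \<times> D" using that by (auto simp: M_def m in_lists_conv_set)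
    then have "d \<in> D" if "map_of R (A \<inter> F) = Some d" for d
      using map_of_SomeD[OF that] by blast
    then show ?thesis using d0 DL by (auto simp: f_def m split: option.split)
  qed
  have 3: "\<kappa> \<le>o |cylinder f M a U|" if aU: "admissible L (Pow ?C) a U" for a U
  proof -
    have a: "finite a" "\<forall>A\<in>a. A \<subseteq> ?C" using aU by (auto simp: admissible_def)
    then obtain F where F: "finite F" "F \<subseteq> ?C" "inj_on (\<lambda>A. A \<inter> F) a"
      by (rule finite_trace_separates)
    have "\<exists>d. d \<in> D \<inter> U A" if A: "A \<in> a" for A
    proof -
      have "openin L (U A)" "U A \<noteq> {}" using A aU by (auto simp: admissible_def)
      then show ?thesis
        using D(1) dense_intersects_open[of L D] unfolding dense_subset_of_def by blast
    qed
    then obtain d where d: "\<And>A. A \<in> a \<Longrightarrow> d A \<in> D \<inter> U A" by metis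
    obtain as where as: "set as = a" "distinct as" using a(1) finite_distinct_list by blast
    define R where "R = map (\<lambda>A. (A \<inter> F, d A)) as"
    have "distinct (map fst R)" using as F(3) by (simp add: R_def distinct_map comp_def)
    then have R: "map_of R (A \<inter> F) = Some (d A)" if "A \<in> a" for A
      using that as by (intro map_of_is_SomeI) (auto simp: R_def)
    have "R \<in> lists (Fpow ?C \<times> D)"
      using F(1,2) d as by (auto simp: R_def Fpow_def)
    then have "(\<lambda>\<alpha>. (\<alpha>, F, R)) ` ?C \<subseteq> cylinder f M a U"
      using F R d by (auto simp: cylinder_def M_def f_def Fpow_def)
    then have "|?C| \<le>o |cylinder f M a U|"
      by (intro card_of_ordLeq[THEN iffD1] exI[of _ "\<lambda>\<alpha>. (\<alpha>, F, R)"]) (auto simp: inj_on_def)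
    then show ?thesis using C ordIso_ordLeq_trans ordIso_symmetric by blast
  qed
  then have "abundant_off \<kappa> L (Pow ?C) M f {}" by (simp add: abundant_off_def)
  with 1 2 show ?thesis using that by blast
qed

lemma abundant_off_reindex:
  assumes "abundant_off \<kappa> L J M f \<J>" "inj_on \<phi> I" "\<phi> ` I \<subseteq> J"
  shows "abundant_off \<kappa> L I M (\<lambda>i. f (\<phi> i)) \<J>"
  unfolding abundant_off_def
proof (intro allI impI, elim conjE)
  fix a U \<F> assume *: "admissible L I a U" "finite \<F>" "\<F> \<subseteq> \<J>"
  define V where "V = (\<lambda>j. U (inv_into I \<phi> j))"
  have V: "V (\<phi> i) = U i" if "i \<in> a" for i
    using that *(1) assms(2) by (auto simp: V_def admissible_def)
  then have "admissible L J (\<phi> ` a) V" using *(1) assms(3) by (auto simp: admissible_def subset_iff)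
  moreover have "cylinder (\<lambda>i. f (\<phi> i)) M a U = cylinder f M (\<phi> ` a) V" using V by (auto simp: cylinder_def)
  ultimately show "\<kappa> \<le>o |cylinder (\<lambda>i. f (\<phi> i)) M a U - \<Union>\<F>|"
    using abundant_offD[OF assms(1)] * by metis
qed

section \<open>Maximal families of negligible sets\<close>

text \<open>
  Zorn's lemma applies because a finite subfamily of the union of a chain is contained in one
  member of the chain.
\<close>

lemma maximal_abundant_off:
  assumes "abundant_off \<kappa> L I M f {}"
  obtains \<J> where "\<J> \<subseteq> Pow M" "abundant_off \<kappa> L I M f \<J>"
    "\<forall>E\<subseteq>M. abundant_off \<kappa> L I M f (insert E \<J>) \<longrightarrow> E \<in> \<J>"
proof -
  define \<A> where "\<A> = {\<J>. \<J> \<subseteq> Pow M \<and> abundant_off \<kappa> L I M f \<J>}"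
  have "\<exists>\<J>\<in>\<A>. \<forall>X\<in>\<A>. \<J> \<subseteq> X \<longrightarrow> X = \<J>"
  proof (rule subset_Zorn_nonempty)
    show "\<A> \<noteq> {}" using assms by (auto simp: \<A>_def)
    fix \<C> assume ne: "\<C> \<noteq> {}" and ch: "subset.chain \<A> \<C>"
    have sub: "\<C> \<subseteq> \<A>" using ch by (simp add: subset.chain_def)
    have "\<kappa> \<le>o |cylinder f M a U - \<Union>\<F>|"
      if "admissible L I a U" and fin: "finite \<F>" and Un: "\<F> \<subseteq> \<Union>\<C>" for a U \<F>
    proof -
      obtain \<B> where "\<B> \<in> \<C>" "\<F> \<subseteq> \<B>"
        using finite_subset_Union_chain[OF fin Un ne ch] by blast
      then show ?thesis using sub that by (auto simp: \<A>_def intro: abundant_offD)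
    qed
    moreover have "\<Union>\<C> \<subseteq> Pow M" using sub by (force simp: \<A>_def)
    ultimately show "\<Union>\<C> \<in> \<A>" by (simp add: \<A>_def abundant_off_def)
  qed
  then obtain \<J> where J: "\<J> \<in> \<A>" "\<And>X. \<lbrakk>X \<in> \<A>; \<J> \<subseteq> X\<rbrakk> \<Longrightarrow> X = \<J>" by blast
  show ?thesis
  proof
    show "\<J> \<subseteq> Pow M" "abundant_off \<kappa> L I M f \<J>" using J(1) by (simp_all add: \<A>_def)
    show "\<forall>E\<subseteq>M. abundant_off \<kappa> L I M f (insert E \<J>) \<longrightarrow> E \<in> \<J>"
    proof (intro allI impI)
      fix E assume "E \<subseteq> M" "abundant_off \<kappa> L I M f (insert E \<J>)"
      then show "E \<in> \<J>" using J(1) J(2)[of "insert E \<J>"] by (auto simp: \<A>_def)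
    qed
  qed
qed

text \<open>
  A set of size below \<open>\<kappa>\<close> is absorbed: for infinite \<open>\<kappa>\<close>, removing it from a set of size at least \<open>\<kappa>\<close>
  leaves at least \<open>\<kappa>\<close> elements.
\<close>

lemma abundant_off_insert_small:
  assumes \<kappa>: "Cinfinite \<kappa>" and J: "abundant_off \<kappa> L I M f \<J>" and S: "|S| <o \<kappa>"
  shows "abundant_off \<kappa> L I M f (insert S \<J>)"
  unfolding abundant_off_def
proof (intro allI impI, elim conjE)
  fix a U \<F> assume *: "admissible L I a U" "finite \<F>" "\<F> \<subseteq> insert S \<J>"
  define B where "B = cylinder f M a U - \<Union>(\<F> - {S})"
  have B: "\<kappa> \<le>o |B|" unfolding B_def using * by (intro abundant_offD[OF J]) auto
  have "\<kappa> \<le>o |B - S|"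
  proof (rule ccontr)
    assume "\<not> \<kappa> \<le>o |B - S|"
    then have "|B - S| <o \<kappa>" by (rule less_if_not_Cinfinite_le[OF \<kappa>])
    then have "|(B - S) \<union> S| <o \<kappa>" using S \<kappa> by (rule Un_Cinfinite_bound_strict)
    moreover have "|B| \<le>o |(B - S) \<union> S|" by (rule card_of_mono1) blast
    ultimately have "|B| <o \<kappa>" by (rule ordLeq_ordLess_trans[rotated])
    then show False using B not_ordLess_ordLeq by blast
  qed
  also have "|B - S| \<le>o |cylinder f M a U - \<Union>\<F>|" by (rule card_of_mono1) (auto simp: B_def)
  finally show "\<kappa> \<le>o |cylinder f M a U - \<Union>\<F>|" .
qed

section \<open>Flattening the functions on the negligible sets\<close>

text \<open>
  The map \<open>\<psi>\<close> assigns to a coordinate \<open>i\<close> the pair \<open>(E, x)\<close> that it has to separate. Here \<open>c\<close> is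
  meant to have no fixed points, so that for \<open>x \<notin> E\<close> the constant value \<open>c (f i x)\<close> on \<open>E\<close> differs
  from the unaltered value at \<open>x\<close>.
\<close>

definition flattened ::
    "'m set set \<Rightarrow> ('i \<Rightarrow> 'm set \<times> 'm) \<Rightarrow> ('a \<Rightarrow> 'a) \<Rightarrow> ('i \<Rightarrow> 'm \<Rightarrow> 'a) \<Rightarrow> 'i \<Rightarrow> 'm \<Rightarrow> 'a"
  where "flattened \<J> \<psi> c f i m =
    (let (E, x) = \<psi> i in if E \<in> \<J> \<and> m \<in> E then c (f i x) else f i m)"

text \<open>
  A coordinate is altered only on its own set, so a basic set changes only within the members of
  \<open>\<J>\<close> that belong to its finitely many coordinates.
\<close>

lemma cylinder_flattened:
  assumes "\<J> \<inter> (fst \<circ> \<psi>) ` a \<subseteq> \<G>"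
  shows "cylinder (flattened \<J> \<psi> c f) M a U - \<Union>\<G> = cylinder f M a U - \<Union>\<G>"
proof -
  have "flattened \<J> \<psi> c f i m = f i m" if "i \<in> a" "m \<notin> \<Union>\<G>" for i m
  proof (cases "\<psi> i")
    case (Pair E x)
    have "\<not> (E \<in> \<J> \<and> m \<in> E)"
    proof
      assume "E \<in> \<J> \<and> m \<in> E"
      moreover have "E \<in> (fst \<circ> \<psi>) ` a" using that(1) Pair by force
      ultimately show False using assms that(2) by blast
    qed
    then show ?thesis by (auto simp: flattened_def Pair)
  qed
  then show ?thesis by (auto simp: cylinder_def)
qed

lemma abundant_off_flattened:
  assumes "abundant_off \<kappa> L I M f \<J>"
  shows "abundant_off \<kappa> L I M (flattened \<J> \<psi> c f) \<J>"
  unfolding abundant_off_def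
proof (intro allI impI, elim conjE)
  fix a U \<F> assume *: "admissible L I a U" "finite \<F>" "\<F> \<subseteq> \<J>"
  let ?g = "flattened \<J> \<psi> c f" and ?G = "\<F> \<union> (\<J> \<inter> (fst \<circ> \<psi>) ` a)"
  have "\<kappa> \<le>o |cylinder f M a U - \<Union>?G|"
    using * by (intro abundant_offD[OF assms]) (auto simp: admissible_def)
  also have "cylinder f M a U - \<Union>?G = cylinder ?g M a U - \<Union>?G"
    by (rule cylinder_flattened[symmetric]) blast
  also have "|cylinder ?g M a U - \<Union>?G| \<le>o |cylinder ?g M a U - \<Union>\<F>|" by (rule card_of_mono1) blast
  finally show "\<kappa> \<le>o |cylinder ?g M a U - \<Union>\<F>|" .
qed

section \<open>The subspace of the power given by a family of functions\<close>

definition evaluation :: "'i set \<Rightarrow> ('i \<Rightarrow> 'm \<Rightarrow> 'a) \<Rightarrow> 'm \<Rightarrow> 'i \<Rightarrow> 'a"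
  where "evaluation I g m = (\<lambda>i\<in>I. g i m)"

lemma kappa_dense_evaluation:
  assumes g: "abundant_off \<kappa> L I M g {}"
    and range: "\<And>i m. \<lbrakk>i \<in> I; m \<in> M\<rbrakk> \<Longrightarrow> g i m \<in> topspace L"
    and inj: "inj_on (evaluation I g) M"
  shows "kappa_dense \<kappa> (product_topology (\<lambda>_. L) I) (evaluation I g ` M)"
  unfolding kappa_dense_def
proof (intro conjI allI impI, goal_cases)
  case 1
  show ?case using range by (auto simp: evaluation_def)
next
  case (2 W)
  then obtain w where "w \<in> W" by blast
  with 2 obtain U where U: "finite {i \<in> I. U i \<noteq> topspace L}"
      "\<forall>i\<in>I. openin L (U i)" "w \<in> Pi\<^sub>E I U" "Pi\<^sub>E I U \<subseteq> W"
    unfolding openin_product_topology_alt by meson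
  let ?a = "{i \<in> I. U i \<noteq> topspace L}"
  have "admissible L I ?a U" using U by (auto simp: admissible_def)
  then have "\<kappa> \<le>o |cylinder g M ?a U|" using abundant_offD[OF g, of ?a U "{}"] by simp
  also have "|cylinder g M ?a U| \<le>o |evaluation I g ` M \<inter> W|"
  proof -
    have "evaluation I g ` cylinder g M ?a U \<subseteq> evaluation I g ` M \<inter> W"
      using U(4) range by (fastforce simp: cylinder_def evaluation_def)
    moreover have "inj_on (evaluation I g) (cylinder g M ?a U)"
      using inj by (rule inj_on_subset) (auto simp: cylinder_def)
    ultimately show ?thesis using card_of_ordLeq by blast
  qed
  finally show ?case .
qed

lemma openin_evaluation_cylinder:
  assumes a: "finite a" "a \<subseteq> I" "\<And>i. i \<in> a \<Longrightarrow> openin L (U i)"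
    and range: "\<And>i m. \<lbrakk>i \<in> I; m \<in> M\<rbrakk> \<Longrightarrow> g i m \<in> topspace L"
  shows "openin (subtopology (product_topology (\<lambda>_. L) I) (evaluation I g ` M))
    (evaluation I g ` cylinder g M a U)"
proof -
  define V where "V = (\<lambda>i. if i \<in> a then U i else topspace L)"
  have "openin (product_topology (\<lambda>_. L) I) (Pi\<^sub>E I V)"
    unfolding openin_PiE_gen
    using a by (auto simp: V_def intro: finite_subset[OF _ a(1)])
  moreover have "m \<in> cylinder g M a U \<longleftrightarrow> m \<in> M \<and> evaluation I g m \<in> Pi\<^sub>E I V" for m
    using a(2) range by (auto simp: cylinder_def evaluation_def V_def PiE_iff)
  then have "evaluation I g ` cylinder g M a U = Pi\<^sub>E I V \<inter> evaluation I g ` M" by blast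
  ultimately show ?thesis unfolding openin_subtopology by blast
qed

lemma crowded_kappa_dense:
  assumes "Cinfinite \<kappa>" "kappa_dense \<kappa> Y X"
  shows "crowded (subtopology Y X)"
  unfolding crowded_def
proof (intro ballI notI)
  fix x assume "openin (subtopology Y X) {x}"
  then obtain W where "openin Y W" "{x} = W \<inter> X" by (auto simp: openin_subtopology)
  moreover from this have "\<kappa> \<le>o |X \<inter> W|" using assms(2) by (auto simp: kappa_dense_def)
  ultimately have "\<kappa> \<le>o |{x}|" by (simp add: Int_commute)
  then show False using not_Cinfinite_le_card_finite[OF assms(1), of "{x}"] by simp
qed

section \<open>Submaximality\<close>

locale maximally_flattened =
  fixes \<kappa> :: "'k rel" and L :: "'a topology" and I :: "'i set" and M :: "'m set"
    and f :: "'i \<Rightarrow> 'm \<Rightarrow> 'a" and \<J> :: "'m set set"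
    and \<psi> :: "'i \<Rightarrow> 'm set \<times> 'm" and c :: "'a \<Rightarrow> 'a"
  assumes \<kappa>: "Cinfinite \<kappa>"
    and t1: "t1_space L"
    and c: "\<And>y. y \<in> topspace L \<Longrightarrow> c y \<in> topspace L \<and> c y \<noteq> y"
    and range: "\<And>i m. \<lbrakk>i \<in> I; m \<in> M\<rbrakk> \<Longrightarrow> f i m \<in> topspace L"
    and \<psi>: "\<psi> ` I = Pow M \<times> M"
    and J_Pow: "\<J> \<subseteq> Pow M"
    and J_abundant: "abundant_off \<kappa> L I M f \<J>"
    and J_maximal: "\<And>E. \<lbrakk>E \<subseteq> M; abundant_off \<kappa> L I M f (insert E \<J>)\<rbrakk> \<Longrightarrow> E \<in> \<J>"
begin

abbreviation "g \<equiv> flattened \<J> \<psi> c f"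
abbreviation "e \<equiv> evaluation I g"
abbreviation "Y \<equiv> product_topology (\<lambda>_. L) I"
abbreviation "Z \<equiv> subtopology Y (e ` M)"

lemma range_g: "g i m \<in> topspace L" if "i \<in> I" "m \<in> M"
proof (cases "\<psi> i")
  case (Pair E x)
  have "\<psi> i \<in> Pow M \<times> M" using imageI[OF that(1), of \<psi>] unfolding \<psi> .
  then have "x \<in> M" by (simp add: Pair)
  then show ?thesis using that range c by (simp add: flattened_def Pair)
qed

lemma small_in_J: "\<lbrakk>S \<subseteq> M; |S| <o \<kappa>\<rbrakk> \<Longrightarrow> S \<in> \<J>"
  using J_maximal abundant_off_insert_small[OF \<kappa> J_abundant] by blast

text \<open>The coordinate reserved for \<open>(E, x)\<close>.\<close>

lemma separating_index:
  assumes E: "E \<in> \<J>" and x: "x \<in> M" "x \<notin> E"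
  obtains i where "i \<in> I" "g i x = f i x" "\<And>m. m \<in> E \<Longrightarrow> g i m = c (f i x)"
proof -
  have "(E, x) \<in> \<psi> ` I" using \<psi> E x J_Pow by blast
  then obtain i where "i \<in> I" "\<psi> i = (E, x)" by (metis imageE)
  then show ?thesis using that E x by (simp add: flattened_def)
qed

text \<open>Singletons are small, hence members of \<open>\<J>\<close>, so some coordinate separates each of them from any other point.\<close>

lemma inj_e: "inj_on e M"
proof (rule inj_onI, rule ccontr)
  fix x y assume xy: "x \<in> M" "y \<in> M" "e x = e y" "x \<noteq> y"
  have "|{y}| <o \<kappa>"
    by (intro less_if_not_Cinfinite_le[OF \<kappa>] not_Cinfinite_le_card_finite[OF \<kappa>]) simp
  then have "{y} \<in> \<J>" using small_in_J xy by blast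
  then obtain i where i: "i \<in> I" "g i x = f i x" "g i y = c (f i x)"
    using separating_index[of "{y}" x] xy by blast
  have "g i x = g i y" using fun_cong[OF xy(3), of i] i(1) by (simp add: evaluation_def)
  then have "c (f i x) = f i x" using i by simp
  then show False using c[OF range[OF i(1) xy(1)]] by blast
qed

lemma kappa_dense_X: "kappa_dense \<kappa> Y (e ` M)"
proof (rule kappa_dense_evaluation)
  show "abundant_off \<kappa> L I M g {}"
    using abundant_off_flattened[OF J_abundant] by (rule abundant_off_mono) simp
qed (rule range_g inj_e; assumption?)+

lemma topspace_Z: "topspace Z = e ` M"
  using kappa_dense_X by (auto simp: kappa_dense_def simp del: topspace_product_topology)

text \<open>
  This is where \<open>T\<^sub>1\<close> enters: the coordinate reserved for \<open>(E, x)\<close> takes a single value on \<open>E\<close>, and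
  avoiding that value is an open condition satisfied by \<open>x\<close>.
\<close>

lemma closedin_J:
  assumes E: "E \<in> \<J>" shows "closedin Z (e ` E)"
proof -
  have EM: "E \<subseteq> M" using E J_Pow by blast
  have "\<exists>T. openin Z T \<and> z \<in> T \<and> T \<subseteq> e ` (M - E)" if z: "z \<in> e ` (M - E)" for z
  proof -
    obtain x where x: "x \<in> M" "x \<notin> E" "z = e x" using z by blast
    obtain i where i: "i \<in> I" "g i x = f i x" "\<And>m. m \<in> E \<Longrightarrow> g i m = c (f i x)"
      using separating_index[OF E x(1,2)] by blast
    define V where "V = topspace L - {c (f i x)}"
    have y: "f i x \<in> topspace L" using i(1) x(1) by (rule range)
    have "openin L V" unfolding V_def
      using closedin_t1_singleton[OF t1] c[OF y] by (intro openin_diff) auto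
    then have "openin Z (e ` cylinder g M {i} (\<lambda>_. V))"
      using i range_g by (intro openin_evaluation_cylinder) auto
    moreover have "x \<in> cylinder g M {i} (\<lambda>_. V)"
      using x(1) i(2) y c[OF y] by (simp add: cylinder_def V_def) metis
    then have "z \<in> e ` cylinder g M {i} (\<lambda>_. V)" unfolding x(3) by (rule imageI)
    moreover have "cylinder g M {i} (\<lambda>_. V) \<subseteq> M - E"
    proof
      fix m assume "m \<in> cylinder g M {i} (\<lambda>_. V)"
      then have "m \<in> M" "g i m \<noteq> c (f i x)" by (simp_all add: cylinder_def V_def)
      then show "m \<in> M - E" using i(3) by blast
    qed
    ultimately show ?thesis by (meson image_mono)
  qed
  then have "openin Z (e ` (M - E))" by (subst openin_subopen) blast
  moreover have "e ` (M - E) = e ` M - e ` E" using EM by (intro inj_on_image_set_diff[OF inj_e]) auto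
  ultimately show ?thesis using image_mono[OF EM] unfolding closedin_def topspace_Z by simp
qed

lemma openin_cylinder_minus:
  assumes "admissible L I a U" "finite \<F>" "\<F> \<subseteq> \<J>"
  shows "openin Z (e ` (cylinder g M a U - \<Union>\<F>))"
proof -
  have "closedin Z (\<Union>E\<in>\<F>. e ` E)"
    using assms closedin_J by (intro closedin_Union) auto
  moreover have "openin Z (e ` cylinder g M a U)"
    using assms(1) range_g by (intro openin_evaluation_cylinder) (auto simp: admissible_def)
  ultimately have "openin Z (e ` cylinder g M a U - (\<Union>E\<in>\<F>. e ` E))" by (rule openin_diff[rotated])
  moreover have "e ` cylinder g M a U - (\<Union>E\<in>\<F>. e ` E) = e ` (cylinder g M a U - \<Union>\<F>)"
  proof -
    have "cylinder g M a U \<subseteq> M" "\<Union>\<F> \<subseteq> M" using assms(3) J_Pow by (auto simp: cylinder_def)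
    then have "e ` (cylinder g M a U - \<Union>\<F>) = e ` cylinder g M a U - e ` \<Union>\<F>"
      by (intro inj_on_image_set_diff[OF inj_e]) auto
    then show ?thesis by (simp add: image_Union)
  qed
  ultimately show ?thesis by simp
qed

text \<open>
  If the complement of a dense set \<open>D\<close> were not in \<open>\<J>\<close>, maximality would give a basic set of the
  original family almost contained in that complement, modulo finitely many members of \<open>\<J>\<close>.
  Enlarging these finitely many members turns it into a nonempty open set of the new space that
  misses \<open>D\<close>.
\<close>

lemma codense_in_J:
  assumes D: "dense_subset_of Z D"
  shows "{m \<in> M. e m \<notin> D} \<in> \<J>" (is "?E \<in> \<J>")
proof (rule ccontr)
  assume "?E \<notin> \<J>"
  then have "\<not> abundant_off \<kappa> L I M f (insert ?E \<J>)" using J_maximal[of ?E] by auto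
  then obtain a U \<F> where aU: "admissible L I a U" and F: "finite \<F>" "\<F> \<subseteq> insert ?E \<J>"
    and small: "\<not> \<kappa> \<le>o |cylinder f M a U - \<Union>\<F>|"
    unfolding abundant_off_def by auto
  \<comment> \<open>The sets attached to the coordinates in \<open>a\<close> are added because off them the original and the
    flattened basic set agree.\<close>
  define \<G> where "\<G> = (\<F> - {?E}) \<union> (\<J> \<inter> (fst \<circ> \<psi>) ` a)"
  have G: "finite \<G>" "\<G> \<subseteq> \<J>" using F aU by (auto simp: \<G>_def admissible_def)
  \<comment> \<open>The points that keep the basic set from lying inside the complement of \<open>D\<close>; being few, they form
    a negligible set themselves.\<close>
  define S where "S = cylinder f M a U - \<Union>\<G> - ?E"
  have "|S| \<le>o |cylinder f M a U - \<Union>\<F>|" by (rule card_of_mono1) (auto simp: S_def \<G>_def)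
  then have "\<not> \<kappa> \<le>o |S|" using small ordLeq_transitive[of \<kappa> "|S|"] by auto
  then have "S \<in> \<J>"
    by (intro small_in_J less_if_not_Cinfinite_le[OF \<kappa>]) (auto simp: S_def cylinder_def)
  then have SG: "finite (insert S \<G>)" "insert S \<G> \<subseteq> \<J>" using G by auto
  let ?O = "cylinder g M a U - \<Union>(insert S \<G>)"
  have eq: "?O = cylinder f M a U - \<Union>(insert S \<G>)"
    by (rule cylinder_flattened) (auto simp: \<G>_def)
  have "?O \<subseteq> ?E" unfolding eq by (auto simp: S_def)
  moreover have "?O \<noteq> {}"
  proof
    assume "?O = {}"
    moreover have "\<kappa> \<le>o |?O|" using abundant_offD[OF J_abundant aU SG] unfolding eq .
    ultimately have "\<kappa> \<le>o |{} :: 'm set|" by (rule subst)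
    then show False using not_Cinfinite_le_card_finite[OF \<kappa> finite.emptyI] by blast
  qed
  ultimately have "e ` ?O \<noteq> {}" "D \<inter> e ` ?O = {}" by auto
  moreover have "openin Z (e ` ?O)" using aU SG by (rule openin_cylinder_minus)
  moreover have "\<forall>T. openin Z T \<and> T \<noteq> {} \<longrightarrow> D \<inter> T \<noteq> {}"
    using D dense_intersects_open[of Z D] unfolding dense_subset_of_def by simp
  ultimately show False by simp
qed

lemma submaximal_X: "submaximal Z"
  unfolding submaximal_def
proof (intro conjI allI impI)
  show "crowded Z" using \<kappa> kappa_dense_X by (rule crowded_kappa_dense)
  fix D assume D: "dense_subset_of Z D"
  then have "D \<subseteq> e ` M" using topspace_Z by (simp add: dense_subset_of_def)
  then have "topspace Z - e ` {m \<in> M. e m \<notin> D} = D" unfolding topspace_Z by blast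
  moreover have "openin Z (topspace Z - e ` {m \<in> M. e m \<notin> D})"
    using closedin_J[OF codense_in_J[OF D]] unfolding closedin_def by (rule conjunct2)
  ultimately show "openin Z D" by (rule subst)
qed

end

theorem theorem3p3:
  fixes L :: "'a topology" and \<kappa> :: "'k rel" and I :: "'i set"
  assumes "t1_space L"
    and "cone <o |topspace L|"
    and "Cinfinite \<kappa>"
    and "top_density L \<le>o \<kappa>"
    and "|I| =o ctwo ^c \<kappa>"
  shows "\<exists>X. X \<subseteq> topspace (product_topology (\<lambda>_. L) I)
    \<and> |X| =o \<kappa>
    \<and> kappa_dense \<kappa> (product_topology (\<lambda>_. L) I) X
    \<and> submaximal (subtopology (product_topology (\<lambda>_. L) I) X)"
proof -
  let ?C = "Field \<kappa>"
  have two: "\<exists>z \<in> topspace L. z \<noteq> y" for y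
  proof (rule ccontr)
    assume "\<not> (\<exists>z \<in> topspace L. z \<noteq> y)"
    then have "inj_on (\<lambda>_. ()) (topspace L)" unfolding inj_on_def by metis
    then have "|topspace L| \<le>o |{()}|" by (intro card_of_ordLeq[THEN iffD1] exI) auto
    then show False using assms(2) not_ordLess_ordLeq[of cone "|topspace L|"] by (simp add: BNF_Cardinal_Arithmetic.cone_def)
  qed
  then obtain c where c: "\<And>y. c y \<in> topspace L \<and> c y \<noteq> y" by metis
  obtain D where D: "dense_subset_of L D" "|D| =o top_density L" using density_attained by blast
  have "D \<noteq> {}" using D(1) two by (auto simp: dense_subset_of_def)
  then obtain M :: "('k \<times> 'k set \<times> ('k set \<times> 'a) list) set" and f
    where M: "|M| =o \<kappa>" and f: "\<And>A m. m \<in> M \<Longrightarrow> f A m \<in> topspace L"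
      "abundant_off \<kappa> L (Pow ?C) M f {}"
    using independent_family_on_Pow[OF assms(3) D(1) ordIso_ordLeq_trans[OF D(2) assms(4)]] by metis
  have C: "|?C| =o \<kappa>" using assms(3) by (intro card_of_Field_ordIso) simp
  have "|Pow ?C| =o ctwo ^c \<kappa>"
    unfolding ctwo_def cexp_def Field_card_of by (rule card_of_Pow_Func)
  then have IC: "|I| =o |Pow ?C|" by (rule ordIso_transitive[OF assms(5) ordIso_symmetric])
  then obtain \<phi> where \<phi>: "bij_betw \<phi> I (Pow ?C)" unfolding card_of_ordIso[symmetric] by metis
  have MC: "|M| =o |?C|" by (rule ordIso_transitive[OF M ordIso_symmetric[OF C]])
  have infM: "infinite M"
    using card_of_ordIso_finite[OF MC] assms(3) by (simp add: cinfinite_def)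
  \<comment> \<open>The \<open>2\<^sup>\<kappa>\<close> coordinates serve twice: \<open>\<phi>\<close> makes them index the independent family, and \<open>\<psi>\<close>
    reserves one of them for each pair of a subset of \<open>M\<close> and an element of \<open>M\<close>.\<close>
  have "|Pow M \<times> M| =o |Pow M|"
  proof (rule card_of_Times_infinite_simps(1))
    show "infinite (Pow M)" "M \<noteq> {}" using infM by auto
    show "|M| \<le>o |Pow M|" by (rule ordLess_imp_ordLeq[OF card_of_Pow])
  qed
  moreover have "|Pow M| =o |Pow ?C|"
    using MC bij_betw_Pow unfolding card_of_ordIso[symmetric] by metis
  ultimately have "|Pow M \<times> M| =o |Pow ?C|" by (rule ordIso_transitive)
  then have "|I| =o |Pow M \<times> M|" by (rule ordIso_transitive[OF IC ordIso_symmetric])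
  then obtain \<psi> where \<psi>: "bij_betw \<psi> I (Pow M \<times> M)" unfolding card_of_ordIso[symmetric] by metis
  have "abundant_off \<kappa> L I M (\<lambda>i. f (\<phi> i)) {}"
    using \<phi> by (intro abundant_off_reindex[OF f(2)]) (auto simp: bij_betw_def)
  then obtain \<J> where J: "\<J> \<subseteq> Pow M" "abundant_off \<kappa> L I M (\<lambda>i. f (\<phi> i)) \<J>"
    "\<forall>E\<subseteq>M. abundant_off \<kappa> L I M (\<lambda>i. f (\<phi> i)) (insert E \<J>) \<longrightarrow> E \<in> \<J>"
    by (rule maximal_abundant_off)
  interpret maximally_flattened \<kappa> L I M "\<lambda>i. f (\<phi> i)" \<J> \<psi> c
    by unfold_locales (use assms(1,3) c f(1) J \<psi> in \<open>auto simp: bij_betw_def\<close>)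
  have "bij_betw e M (e ` M)" using inj_e by (rule inj_on_imp_bij_betw)
  then have "|M| =o |e ` M|" by (intro card_of_ordIso[THEN iffD1] exI)
  then have "|e ` M| =o \<kappa>" by (rule ordIso_transitive[OF ordIso_symmetric M])
  moreover have "e ` M \<subseteq> topspace Y" using kappa_dense_X by (simp add: kappa_dense_def)
  ultimately show ?thesis using kappa_dense_X submaximal_X by blast
qed

end
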